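(* Let $\mathcal{A}\in T_{m,n}$ be a $Z$-tensor and let $q\in\mathbb{R}^n$. If $\mathrm{FEA}(q,\mathcal{A})\neq\emptyset$, then the least element $u$ of $\mathrm{FEA}(q,\mathcal{A})$ is a sparse solution of $\mathrm{TCP}(q,\mathcal{A})$.
   Context: $T_{m,n}$ is the set of real tensors $\mathcal{A}=(a_{i_1\ldots i_m})$ of order $m\ge 2$ and dimension $n$ (all indices range over $[n]=\{1,\ldots,n\}$). For $u\in\mathbb{R}^n$, $\mathcal{A}u^{m-1}\in\mathbb{R}^n$ is the vector with $(\mathcal{A}u^{m-1})_i=\sum_{i_2,\ldots,i_m=1}^n a_{i i_2\ldots i_m}u_{i_2}\cdots u_{i_m}$. $\mathcal{A}$ is a $Z$-tensor if all its off-diagonal entries (those $a_{i_1\ldots i_m}$ for which $i_1,\ldots,i_m$ are not all equal) are nonpositive. $\mathrm{FEA}(q,\mathcal{A})=\{u\in\mathbb{R}^n: u\ge 0,\ \mathcal{A}u^{m-1}+q\ge 0\}$ (componentwise inequalities). $\mathrm{TCP}(q,\mathcal{A})$ is the problem of finding $u\in\mathrm{FEA}(q,\mathcal{A})$ with $u^T(\mathcal{A}u^{m-1}+q)=0$; the set of all such $u$ is $\mathrm{SOL}(q,\mathcal{A})$. An element $u$ of $S\subseteq\mathbb{R}^n$ is the least element of $S$ if $u\le v$ (componentwise) for all $v\in S$. It is a known result (Luo, Qi and Xiu) that for a $Z$-tensor $\mathcal{A}$ with $\mathrm{FEA}(q,\mathcal{A})\ne\emptyset$, $\mathrm{FEA}(q,\mathcal{A})$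 has a unique least element, and it belongs to $\mathrm{SOL}(q,\mathcal{A})$. $\|u\|_0$ denotes the number of nonzero components of $u$. A sparse solution of $\mathrm{TCP}(q,\mathcal{A})$ is an element $u^*\in\mathrm{SOL}(q,\mathcal{A})$ with $\|u^*\|_0\le\|u\|_0$ for all $u\in\mathrm{SOL}(q,\mathcal{A})$. *)

theory Defs
  imports "HOL-Analysis.Analysis"
begin

text \<open>
  A real tensor of order m and dimension CARD('n) is a function on the index tuples
  (i_1, ..., i_m), encoded as lists over 'n of length m; it is undefined
  on lists of any other length, so that tensors correspond exactly to arrays of entries.
  Vectors have type real^'n, whose library order is the componentwise one.
\<close>

definition tensors :: "nat \<Rightarrow> ('n::finite list \<Rightarrow> real) set" where
  "tensors m = {is. length is = m} \<rightarrow>\<^sub>E UNIV"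

text \<open>The vector A u^(m-1); the list js is (i_2, ..., i_m). Meaningful for m at least 1.\<close>

definition tensor_apply :: "nat \<Rightarrow> ('n::finite list \<Rightarrow> real) \<Rightarrow> real^'n \<Rightarrow> real^'n" where
  "tensor_apply m A u =
     (\<chi> i. \<Sum>js | length js = m - 1. A (i # js) * prod_list (map (\<lambda>j. u $ j) js))"

definition Z_tensor :: "nat \<Rightarrow> ('n::finite list \<Rightarrow> real) \<Rightarrow> bool" where
  "Z_tensor m A \<longleftrightarrow>
     (\<forall>is. length is = m \<and> \<not> (\<forall>j\<in>set is. \<forall>k\<in>set is. j = k) \<longrightarrow> A is \<le> 0)"

definition FEA :: "nat \<Rightarrow> real^'n \<Rightarrow> ('n::finite list \<Rightarrow> real) \<Rightarrow> (real^'n) set" where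
  "FEA m q A = {u. 0 \<le> u \<and> 0 \<le> tensor_apply m A u + q}"

definition SOL :: "nat \<Rightarrow> real^'n \<Rightarrow> ('n::finite list \<Rightarrow> real) \<Rightarrow> (real^'n) set" where
  "SOL m q A = {u \<in> FEA m q A. u \<bullet> (tensor_apply m A u + q) = 0}"

definition least_element :: "(real^'n::finite) set \<Rightarrow> real^'n \<Rightarrow> bool" where
  "least_element S u \<longleftrightarrow> u \<in> S \<and> (\<forall>v\<in>S. u \<le> v)"

definition norm0 :: "real^'n::finite \<Rightarrow> nat" where
  "norm0 u = card {i. u $ i \<noteq> 0}"

definition sparse_solution ::
  "nat \<Rightarrow> real^'n \<Rightarrow> ('n::finite list \<Rightarrow> real) \<Rightarrow> real^'n \<Rightarrow> bool" where
  "sparse_solution m q A u \<longleftrightarrow>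
     u \<in> SOL m q A \<and> (\<forall>v\<in>SOL m q A. norm0 u \<le> norm0 v)"

end

theory Submission
  imports Defs
begin

text \<open>
  For a Z-tensor, lowering coordinates of a nonnegative vector while keeping the i-th one can only
  raise the i-th entry of \<open>A u\<^sup>m\<^sup>-\<^sup>1\<close>: the diagonal monomial is unchanged, and every other monomial
  shrinks but has a nonpositive coefficient. The whole argument rests on this
  antitonicity (\<open>tensor_apply_antimono_fixed_component\<close>).

  First, the feasible set is closed under componentwise minima, since at each index the minimum
  agrees with one of the two vectors and lies below it. As the feasible set is also closed and
  bounded below, a feasible point of smallest coordinate sum below a given one exists, and its
  minimum with any other feasible point cannot be smaller, so it is the least element. Second, the
  least element is complementary: at an index where both the coordinate and the slack are
  positive, the coordinate could be lowered a little, where antitonicity protects all other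
  constraints and continuity protects the one at that index. Finally, a nonnegative vector below
  every solution has its support inside the support of every solution.
\<close>

lemma tensor_apply_nth:
  "tensor_apply m A u $ i = (\<Sum>js | length js = m - 1. A (i # js) * prod_list (map (\<lambda>j. u $ j) js))"
  by (simp add: tensor_apply_def)

lemma continuous_on_tensor_apply_nth:
  "continuous_on S (\<lambda>u. tensor_apply m A u $ i)"
proof -
  have "continuous_on S (\<lambda>u. prod_list (map (\<lambda>j. u $ j) js))" for js :: "'a list"
    by (induction js) (auto intro!: continuous_intros)
  then show ?thesis
    unfolding tensor_apply_nth by (intro continuous_intros)
qed

lemma prod_list_map_mono_nonneg:
  fixes f g :: "'a \<Rightarrow> real"
  assumes "\<And>x. x \<in> set xs \<Longrightarrow> 0 \<le> f x" and "\<And>x. x \<in> set xs \<Longrightarrow> f x \<le> g x"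
  shows "0 \<le> prod_list (map f xs) \<and> prod_list (map f xs) \<le> prod_list (map g xs)"
  using assms
proof (induction xs)
  case (Cons x xs)
  then have "0 \<le> prod_list (map f xs)" "prod_list (map f xs) \<le> prod_list (map g xs)"
    and "0 \<le> f x" "f x \<le> g x"
    by auto
  then show ?case
    using mult_mono[of "f x" "g x" "prod_list (map f xs)" "prod_list (map g xs)"] by auto
qed simp

text \<open>
  Among the monomials of the i-th entry only the one built from i alone may have a positive
  coefficient, and it depends only on the coordinate that the two vectors share.
\<close>

lemma tensor_apply_antimono_fixed_component:
  fixes u w :: "real^'n::finite"
  assumes Z: "Z_tensor m A" and "m \<ge> 1"
    and w: "0 \<le> w" "w \<le> u" and eq: "w $ i = u $ i"
  shows "tensor_apply m A u $ i \<le> tensor_apply m A w $ i"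
  unfolding tensor_apply_nth
proof (rule sum_mono)
  fix js :: "'n list" assume "js \<in> {js. length js = m - 1}"
  then have len: "length (i # js) = m" using \<open>m \<ge> 1\<close> by simp
  show "A (i # js) * prod_list (map (\<lambda>j. u $ j) js) \<le> A (i # js) * prod_list (map (\<lambda>j. w $ j) js)"
  proof (cases "\<forall>j\<in>set js. j = i")
    case True
    then have "map (\<lambda>j. u $ j) js = map (\<lambda>j. w $ j) js" using eq by auto
    then show ?thesis by (simp only: order_refl)
  next
    case False
    then have "A (i # js) \<le> 0" using Z len unfolding Z_tensor_def by fastforce
    moreover have "prod_list (map (\<lambda>j. w $ j) js) \<le> prod_list (map (\<lambda>j. u $ j) js)"
      using prod_list_map_mono_nonneg[of js "\<lambda>j. w $ j" "\<lambda>j. u $ j"] w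
      by (auto simp: less_eq_vec_def)
    ultimately show ?thesis by (rule mult_left_mono_neg[rotated])
  qed
qed

lemma mem_FEA_iff:
  "u \<in> FEA m q A \<longleftrightarrow> (\<forall>i. 0 \<le> u $ i) \<and> (\<forall>i. 0 \<le> tensor_apply m A u $ i + q $ i)"
  by (simp add: FEA_def less_eq_vec_def)

lemma inf_in_FEA:
  fixes u v :: "real^'n::finite"
  assumes Z: "Z_tensor m A" "m \<ge> 1" and u: "u \<in> FEA m q A" and v: "v \<in> FEA m q A"
  shows "inf u v \<in> FEA m q A"
proof -
  have nonneg: "0 \<le> inf u v" using u v by (simp add: FEA_def)
  have "0 \<le> tensor_apply m A (inf u v) $ i + q $ i" for i
  proof (cases "u $ i \<le> v $ i")
    case True
    then have "tensor_apply m A u $ i \<le> tensor_apply m A (inf u v) $ i"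
      by (intro tensor_apply_antimono_fixed_component[OF Z nonneg])
         (auto simp: inf_vec_def inf_real_def less_eq_vec_def)
    with u show ?thesis unfolding mem_FEA_iff by (smt (verit))
  next
    case False
    then have "tensor_apply m A v $ i \<le> tensor_apply m A (inf u v) $ i"
      by (intro tensor_apply_antimono_fixed_component[OF Z nonneg])
         (auto simp: inf_vec_def inf_real_def less_eq_vec_def)
    with v show ?thesis unfolding mem_FEA_iff by (smt (verit))
  qed
  with nonneg show ?thesis by (simp add: mem_FEA_iff less_eq_vec_def)
qed

lemma closed_FEA:
  fixes q :: "real^'n::finite"
  shows "closed (FEA m q A)"
proof -
  have "FEA m q A = (\<Inter>i. {u. 0 \<le> u $ i}) \<inter> (\<Inter>i. {u. 0 \<le> tensor_apply m A u $ i + q $ i})"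
    by (auto simp: mem_FEA_iff)
  moreover have "closed {u :: real^'n. 0 \<le> u $ i}" for i :: 'n
    by (intro closed_Collect_le continuous_intros)
  moreover have "closed {u. 0 \<le> tensor_apply m A u $ i + q $ i}" for i
    by (intro closed_Collect_le continuous_intros continuous_on_tensor_apply_nth)
  ultimately show ?thesis by (simp add: closed_INT closed_Int)
qed

text \<open>
  The coordinate sum is strictly monotone, so a minimiser of it that is compared with its
  minimum with another point of the set must already lie below that point.
\<close>

lemma least_element_exists:
  fixes S :: "(real^'n::finite) set"
  assumes "closed S" and "S \<noteq> {}" and nonneg: "\<And>u. u \<in> S \<Longrightarrow> 0 \<le> u"
    and inf: "\<And>u v. u \<in> S \<Longrightarrow> v \<in> S \<Longrightarrow> inf u v \<in> S"
  shows "\<exists>u. least_element S u"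
proof -
  obtain v where v: "v \<in> S" using \<open>S \<noteq> {}\<close> by blast
  have "compact (S \<inter> {0..v})"
    using \<open>closed S\<close> compact_interval closed_Int_compact by blast
  moreover have "v \<in> S \<inter> {0..v}" using v nonneg by auto
  moreover have "continuous_on (S \<inter> {0..v}) (\<lambda>u. \<Sum>i\<in>UNIV. u $ i)"
    by (intro continuous_intros)
  ultimately obtain u where u: "u \<in> S" "u \<le> v"
    and min: "\<And>w. w \<in> S \<Longrightarrow> w \<le> v \<Longrightarrow> (\<Sum>i\<in>UNIV. u $ i) \<le> (\<Sum>i\<in>UNIV. w $ i)"
    using continuous_attains_inf[of "S \<inter> {0..v}" "\<lambda>u. \<Sum>i\<in>UNIV. u $ i"] nonneg
    by (metis Int_iff atLeastAtMost_iff empty_iff)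
  have "u \<le> w" if w: "w \<in> S" for w
  proof (rule ccontr)
    assume "\<not> u \<le> w"
    then obtain k where k: "w $ k < u $ k" by (auto simp: less_eq_vec_def not_le)
    have "(\<Sum>i\<in>UNIV. inf u w $ i) < (\<Sum>i\<in>UNIV. u $ i)"
      using k by (intro sum_strict_mono_ex1) (auto simp: inf_vec_def inf_real_def intro!: exI[of _ k])
    moreover have "inf u w \<le> v" using u(2) by (simp add: le_infI1)
    ultimately show False using min[OF inf[OF u(1) w]] by simp
  qed
  with u(1) show ?thesis unfolding least_element_def by blast
qed

text \<open>
  A coordinate that is positive together with its slack could be lowered inside the feasible set,
  so minimality forces the two to be complementary.
\<close>

lemma least_element_in_SOL:
  fixes u q :: "real^'n::finite"
  assumes Z: "Z_tensor m A" "m \<ge> 1" and least: "least_element (FEA m q A) u"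
  shows "u \<in> SOL m q A"
proof -
  have u: "u \<in> FEA m q A" and le: "\<And>v. v \<in> FEA m q A \<Longrightarrow> u \<le> v"
    using least by (auto simp: least_element_def)
  define F where "F = (\<lambda>v i. tensor_apply m A v $ i + q $ i)"
  have u0: "\<And>i. 0 \<le> u $ i" and F0: "\<And>i. 0 \<le> F u i"
    using u by (auto simp: mem_FEA_iff F_def)
  have "u $ i * F u i = 0" for i
  proof (rule ccontr)
    assume "u $ i * F u i \<noteq> 0"
    then have ui: "0 < u $ i" and Fi: "0 < F u i" using u0[of i] F0[of i] by (auto simp: less_le)
    have "continuous_on UNIV (\<lambda>t. F (u - t *\<^sub>R axis i 1) i)"
      unfolding F_def
      by (intro continuous_intros continuous_on_compose2[OF continuous_on_tensor_apply_nth[of UNIV]])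
         auto
    then have "((\<lambda>t. F (u - t *\<^sub>R axis i 1) i) \<longlongrightarrow> F (u - 0 *\<^sub>R axis i 1) i) (at_right 0)"
      unfolding continuous_on_def by (metis UNIV_I subset_UNIV tendsto_within_subset)
    then have "\<forall>\<^sub>F t in at_right 0. 0 < F (u - t *\<^sub>R axis i 1) i"
      using Fi by (intro order_tendstoD(1)) auto
    moreover have "\<forall>\<^sub>F t in at_right 0. 0 < t \<and> t < u $ i"
      using ui by (auto simp: eventually_at_right_less eventually_at_right_field eventually_conj_iff)
    ultimately have "\<forall>\<^sub>F t in at_right 0. 0 < F (u - t *\<^sub>R axis i 1) i \<and> 0 < t \<and> t < u $ i"
      by (rule eventually_conj)
    then obtain t where Ft: "0 < F (u - t *\<^sub>R axis i 1) i" and t: "0 < t" "t < u $ i"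
      using eventually_happens'[of "at_right (0::real)"] by force
    define w where "w = u - t *\<^sub>R axis i 1"
    have w: "w $ j = (if j = i then u $ i - t else u $ j)" for j
      by (simp add: w_def axis_def)
    have w0: "0 \<le> w" and wu: "w \<le> u" using t u0 by (auto simp: w less_eq_vec_def)
    have "0 \<le> F w j" for j
    proof (cases "j = i")
      case True
      then show ?thesis using Ft by (simp add: w_def)
    next
      case False
      then show ?thesis
        using tensor_apply_antimono_fixed_component[OF Z w0 wu, of j] F0[of j]
        by (simp add: w F_def)
    qed
    then have "w \<in> FEA m q A" using w0 by (simp add: mem_FEA_iff F_def less_eq_vec_def)
    then have "u $ i \<le> w $ i" using le by (simp add: less_eq_vec_def)
    then show False using t by (simp add: w)
  qed
  then have "u \<bullet> (tensor_apply m A u + q) = 0" unfolding inner_vec_def F_def by (intro sum.neutral) simp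
  with u show ?thesis by (simp add: SOL_def)
qed

lemma norm0_mono:
  assumes "0 \<le> u" and "u \<le> v"
  shows "norm0 u \<le> norm0 v"
  unfolding norm0_def
proof (rule card_mono)
  show "{i. u $ i \<noteq> 0} \<subseteq> {i. v $ i \<noteq> 0}"
    using assms by (auto simp: less_eq_vec_def) (metis antisym)
qed simp

theorem theorem3p2:
  fixes m :: nat and A :: "'n::finite list \<Rightarrow> real" and q :: "real^'n"
  assumes "m \<ge> 2"
    and "A \<in> tensors m"
    and "Z_tensor m A"
    and "FEA m q A \<noteq> {}"
  shows "(\<exists>!u. least_element (FEA m q A) u) \<and>
         (\<forall>u. least_element (FEA m q A) u \<longrightarrow> sparse_solution m q A u)"
proof (intro conjI allI impI)
  have m: "m \<ge> 1" using assms(1) by simp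
  have "\<exists>u. least_element (FEA m q A) u"
    by (rule least_element_exists[OF closed_FEA assms(4)])
       (simp add: FEA_def, rule inf_in_FEA[OF assms(3) m])
  moreover have "u = v" if "least_element (FEA m q A) u" "least_element (FEA m q A) v" for u v
    using that by (meson antisym least_element_def)
  ultimately show "\<exists>!u. least_element (FEA m q A) u" by blast
  fix u assume u: "least_element (FEA m q A) u"
  have "norm0 u \<le> norm0 v" if "v \<in> SOL m q A" for v
    using that u by (intro norm0_mono) (auto simp: least_element_def SOL_def FEA_def)
  then show "sparse_solution m q A u"
    using least_element_in_SOL[OF assms(3) m u] by (simp add: sparse_solution_def)
qed

end
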